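(* Let $K = T \times I \subseteq \mathbb{R}^3$, where $T$ is an equilateral triangle and $I$ is a (nondegenerate, compact) line segment orthogonal to $T$, and let $p_0 \in K$ be the point of maximal depth of $K$ (which in this case coincides with the barycenter of $K$). Then there are only $3$ hyperplanes through $p_0$ realizing the depth of $p_0$, i.e. the number of distinct such hyperplanes is exactly $3$.
   Context: Let $\lambda$ be the Lebesgue measure on $\mathbb{R}^n$ (here $n=3$) and let $K \subseteq \mathbb{R}^n$ be a convex body, i.e. a compact convex set with nonempty interior. For a point $p$ in $K$ and a unit vector $v \in S^{n-1}$, let $h_v^p = \{x \in \mathbb{R}^n : \langle v, x-p\rangle = 0\}$ and $H_v^p = \{x \in \mathbb{R}^n : \langle v, x-p\rangle \geq 0\}$, and define $\delta^p(v) = \lambda(H_v^p \cap K)/\lambda(K)$. The depth of $p$ in $K$ is $\mathrm{depth}(p,K) = \inf_{v \in S^{n-1}} \delta^p(v)$ (the infimum is attained). A hyperplane $h$ through $p$ realizes the depth of $p$ if $h = h_v^p$ for some $v \in S^{n-1}$ with $\delta^p(v) = \mathrm{depth}(p,K)$. The point of maximal depth of $K$ is the point $p_0$ in the interior of $K$ at which $\mathrm{depth}(p,K)$ attains its maximum over all interior points $p$ of $K$; it exists and is unique. The barycenter of $K$ is $\frac{1}{\lambda(K)}\int_K x\,dx$. *)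

theory Defs
  imports "HOL-Analysis.Analysis"
begin

definition hyperplane_at :: "'a::euclidean_space \<Rightarrow> 'a \<Rightarrow> 'a set" where
  "hyperplane_at p v = {x. v \<bullet> (x - p) = 0}"

definition halfspace_at :: "'a::euclidean_space \<Rightarrow> 'a \<Rightarrow> 'a set" where
  "halfspace_at p v = {x. v \<bullet> (x - p) \<ge> 0}"

definition cut_fraction :: "'a::euclidean_space set \<Rightarrow> 'a \<Rightarrow> 'a \<Rightarrow> real" where
  "cut_fraction K p v = measure lebesgue (halfspace_at p v \<inter> K) / measure lebesgue K"

definition depth :: "'a::euclidean_space \<Rightarrow> 'a set \<Rightarrow> real" where
  "depth p K = (INF v\<in>sphere 0 1. cut_fraction K p v)"

definition realizes_depth :: "'a::euclidean_space set \<Rightarrow> 'a \<Rightarrow> 'a set \<Rightarrow> bool" where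
  "realizes_depth K p h \<longleftrightarrow>
     (\<exists>v\<in>sphere 0 1. h = hyperplane_at p v \<and> cut_fraction K p v = depth p K)"

definition max_depth_point :: "'a::euclidean_space set \<Rightarrow> 'a \<Rightarrow> bool" where
  "max_depth_point K p \<longleftrightarrow>
     p \<in> interior K \<and> (\<forall>q\<in>interior K. depth q K \<le> depth p K)"

definition barycenter :: "'a::euclidean_space set \<Rightarrow> 'a" where
  "barycenter K = (1 / measure lebesgue K) *\<^sub>R (LINT x:K|lebesgue. x)"

definition equilateral_triangle :: "'a::euclidean_space set \<Rightarrow> bool" where
  "equilateral_triangle T \<longleftrightarrow>
     (\<exists>a b c. a \<noteq> b \<and> dist a b = dist b c \<and> dist b c = dist c a \<and> T = convex hull {a, b, c})"

definition nondegenerate_segment :: "'a::euclidean_space set \<Rightarrow> bool" where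
  "nondegenerate_segment I \<longleftrightarrow> (\<exists>a b. a \<noteq> b \<and> I = closed_segment a b)"

definition orthogonal_sets :: "'a::euclidean_space set \<Rightarrow> 'a set \<Rightarrow> bool" where
  "orthogonal_sets A B \<longleftrightarrow> (\<forall>x\<in>A. \<forall>y\<in>A. \<forall>s\<in>B. \<forall>t\<in>B. orthogonal (x - y) (s - t))"

text \<open>For orthogonal \<open>A\<close> and \<open>B\<close> inside one Euclidean space, the product \<open>A \<times> B\<close> is the
  Minkowski sum; moving either factor within the space only translates the result.\<close>

definition internal_product :: "'a::euclidean_space set \<Rightarrow> 'a set \<Rightarrow> 'a set" where
  "internal_product A B = {x + y | x y. x \<in> A \<and> y \<in> B}"

end

theory Submission
  imports Defs
begin

text \<open>
  Cut fractions, depth and barycenter are compatible with affine bijections, and the body is an affine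
  image of one standard prism over a right triangle (\<open>triangular_prism_affine_image\<close>). So only the standard
  prism has to be studied, and its point of maximal depth turns out to be its center, of depth \<open>4/9\<close>.

  Slice the prism horizontally. A half-space whose boundary passes through the center cuts the slice at
  height \<open>s\<close> in the part of the triangle above some level of a linear function \<open>w\<close>, and relative to the
  mean of \<open>w\<close> the levels at the heights \<open>s\<close> and \<open>- s\<close> are opposite. The heart of the proof is a planar
  estimate, \<open>upper_area_opposite_levels\<close>: the parts of a triangle above opposite levels \<open>t\<close> and \<open>- t\<close>
  together have more than \<open>8/9\<close> of its area, apart from finitely many \<open>t\<close>. Hence a half-space with a
  tilted boundary contains more than \<open>4/9\<close> of the prism. If the boundary is vertical, all slices agree and
  \<open>upper_area_through_centroid\<close> gives at least \<open>4/9\<close>, with equality only for lines parallel to a side. The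
  center has therefore depth \<open>4/9\<close>, realized exactly by the three vertical planes parallel to a side face.

  Any other interior point is less deep (\<open>max_depth_point_prism\<close>). If it does not lie above the centroid of
  the base, it is farther from some side face than the center is, and the plane through it parallel to that
  face cuts off less than \<open>4/9\<close>. If it lies above the centroid at another height, a slightly tilted
  plane cuts off less than \<open>4/9\<close> (\<open>cut_fraction_tilted\<close>). The center is also the barycenter, by symmetry.
\<close>

section \<open>Affine invariance\<close>

text \<open>A half-space is given by a covector, so a normal vector is transported by the adjoint of the
  linear part.\<close>

lemma halfspace_at_affine_image:
  fixes L :: "'a::euclidean_space \<Rightarrow> 'b::euclidean_space"
  assumes "linear L" "inj L"
  shows "halfspace_at (q + L p) v \<inter> (\<lambda>x. q + L x) ` P
           = (\<lambda>x. q + L x) ` (halfspace_at p (adjoint L v) \<inter> P)"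
proof -
  have "v \<bullet> (q + L x - (q + L p)) = adjoint L v \<bullet> (x - p)" for x
    using adjoint_clauses(2)[OF assms(1), of v "x - p"] by (simp add: linear_diff[OF assms(1)])
  then show ?thesis
    by (auto simp: halfspace_at_def)
qed

lemma hyperplane_at_affine_image:
  fixes L :: "'a::euclidean_space \<Rightarrow> 'b::euclidean_space"
  assumes "linear L" "surj L"
  shows "hyperplane_at (q + L p) v = (\<lambda>x. q + L x) ` hyperplane_at p (adjoint L v)"
proof -
  have *: "v \<bullet> (q + L x - (q + L p)) = adjoint L v \<bullet> (x - p)" for x
    using adjoint_clauses(2)[OF assms(1), of v "x - p"] by (simp add: linear_diff[OF assms(1)])
  have ex: "\<exists>x. y = q + L x" for y
    using surjD[OF assms(2), of "y - q"] by (metis add.commute diff_add_cancel)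
  show ?thesis
  proof (intro equalityI subsetI)
    fix y assume y: "y \<in> hyperplane_at (q + L p) v"
    obtain x where x: "y = q + L x"
      using ex by blast
    with y * show "y \<in> (\<lambda>x. q + L x) ` hyperplane_at p (adjoint L v)"
      by (auto simp: hyperplane_at_def)
  qed (use * in \<open>auto simp: hyperplane_at_def\<close>)
qed

lemma measure_affine_image:
  fixes L :: "real^'n::{finite,wellorder} \<Rightarrow> real^'n::_"
  assumes "linear L" "S \<in> lmeasurable"
  shows "measure lebesgue ((\<lambda>x. q + L x) ` S) = \<bar>det (matrix L)\<bar> * measure lebesgue S"
  using measure_translation[of q "L ` S"] measure_linear_image[OF assms]
  by (simp add: image_image)

lemma closed_halfspace_at: "closed (halfspace_at p v)"
proof -
  have "halfspace_at p v = {x. v \<bullet> x \<ge> v \<bullet> p}"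
    by (auto simp: halfspace_at_def inner_diff_right)
  then show ?thesis
    by (simp add: closed_halfspace_ge)
qed

text \<open>The determinant of \<open>L\<close> scales both the section and the whole body, so it cancels in the
  quotient.\<close>

lemma cut_fraction_affine_image:
  fixes L :: "real^'n::{finite,wellorder} \<Rightarrow> real^'n::_"
  assumes "linear L" "inj L" "compact P"
  shows "cut_fraction ((\<lambda>x. q + L x) ` P) (q + L p) v = cut_fraction P p (adjoint L v)"
proof -
  have "P \<in> lmeasurable" "halfspace_at p (adjoint L v) \<inter> P \<in> lmeasurable"
    using assms(3) closed_halfspace_at lmeasurable_compact by (blast, metis closed_Int_compact)
  then show ?thesis
    using assms(2) det_nz_iff_inj[OF assms(1)]
    by (simp add: cut_fraction_def halfspace_at_affine_image[OF assms(1,2)]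
        measure_affine_image[OF assms(1)])
qed

lemma halfspace_at_scaleR: "k > 0 \<Longrightarrow> halfspace_at p (k *\<^sub>R v) = halfspace_at p v"
  by (auto simp: halfspace_at_def zero_le_mult_iff)

lemma hyperplane_at_scaleR: "k \<noteq> 0 \<Longrightarrow> hyperplane_at p (k *\<^sub>R v) = hyperplane_at p v"
  by (auto simp: hyperplane_at_def)

lemma cut_fraction_scaleR: "k > 0 \<Longrightarrow> cut_fraction P p (k *\<^sub>R v) = cut_fraction P p v"
  by (simp add: cut_fraction_def halfspace_at_scaleR)

lemma inj_adjoint:
  fixes L :: "'a::euclidean_space \<Rightarrow> 'a"
  assumes "linear L" "inj L"
  shows "inj (adjoint L)"
proof -
  have "v = 0" if "adjoint L v = 0" for v
  proof -
    have "surj L"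
      using assms linear_injective_imp_surjective by blast
    then obtain x where "v = L x"
      by blast
    then show ?thesis
      using adjoint_clauses(2)[OF assms(1), of v x] that by simp
  qed
  then show ?thesis
    using linear_injective_0[OF adjoint_linear[OF assms(1)]] by blast
qed

text \<open>The adjoint does not preserve unit vectors, but neither the cut fraction nor the hyperplane
  changes when a normal vector is rescaled by a positive factor. Carrying the two quantities as a
  pair gives the invariance both of the depth and of the hyperplanes that realize it.\<close>

lemma direction_affine_image:
  fixes L :: "real^'n::{finite,wellorder} \<Rightarrow> real^'n::_" and q p :: "real^'n::_"
  assumes L: "linear L" "inj L" "compact P"
  defines "F \<equiv> \<lambda>x. q + L x"
  shows "(\<lambda>v. (cut_fraction (F ` P) (F p) v, hyperplane_at (F p) v)) ` sphere 0 1
       = (\<lambda>v. (cut_fraction P p v, F ` hyperplane_at p v)) ` sphere 0 1" (is "?f ` _ = ?g ` _")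
proof -
  have surj: "surj L"
    using linear_injective_imp_surjective[OF L(1,2)] by simp
  have fg: "?f v = ?g (adjoint L v)" for v
    unfolding F_def using cut_fraction_affine_image[OF L, of q p v]
      hyperplane_at_affine_image[OF L(1) surj, of q p v] by simp
  have scale: "?f (k *\<^sub>R v) = ?f v" "?g (k *\<^sub>R v) = ?g v" if "k > 0" for k v
    using that by (simp_all add: cut_fraction_scaleR hyperplane_at_scaleR)
  have adj: "linear (adjoint L)" "inj (adjoint L)"
    using adjoint_linear[OF L(1)] inj_adjoint[OF L(1,2)] .
  then have "surj (adjoint L)"
    using linear_injective_imp_surjective by blast
  have "?f v \<in> ?g ` sphere 0 1" if "v \<in> sphere 0 1" for v
  proof -
    let ?w = "adjoint L v"
    have "?w \<noteq> 0"
      using that linear_injective_0[OF adj(1)] adj(2) by fastforce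
    then show ?thesis
      using fg[of v] scale(2)[of "1 / norm ?w" ?w] image_eqI[of "?f v" ?g "(1 / norm ?w) *\<^sub>R ?w"]
      by simp
  qed
  moreover have "?g u \<in> ?f ` sphere 0 1" if u: "u \<in> sphere 0 1" for u
  proof -
    obtain w where w: "u = adjoint L w"
      using \<open>surj (adjoint L)\<close> by blast
    then have "w \<noteq> 0"
      using u adj(1) linear_0 by fastforce
    then show ?thesis
      using fg[of w] w scale(1)[of "1 / norm w" w] image_eqI[of "?g u" ?f "(1 / norm w) *\<^sub>R w"]
      by simp
  qed
  ultimately show ?thesis
    by blast
qed

lemma depth_affine_image:
  fixes L :: "real^'n::{finite,wellorder} \<Rightarrow> real^'n::_"
  assumes "linear L" "inj L" "compact P"
  shows "depth (q + L p) ((\<lambda>x. q + L x) ` P) = depth p P"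
  using arg_cong[OF direction_affine_image[OF assms, of q p], of "\<lambda>S. Inf (fst ` S)"]
  by (simp add: depth_def image_image)

lemma realizes_depth_affine_image:
  fixes L :: "real^'n::{finite,wellorder} \<Rightarrow> real^'n::_"
  assumes "linear L" "inj L" "compact P"
  shows "{h. realizes_depth ((\<lambda>x. q + L x) ` P) (q + L p) h}
       = image (\<lambda>x. q + L x) ` {h. realizes_depth P p h}"
proof -
  have A: "{h. realizes_depth ((\<lambda>x. q + L x) ` P) (q + L p) h}
    = {h. (depth p P, h) \<in> (\<lambda>v. (cut_fraction ((\<lambda>x. q + L x) ` P) (q + L p) v,
         hyperplane_at (q + L p) v)) ` sphere 0 1}"
    unfolding realizes_depth_def depth_affine_image[OF assms] by (auto simp: image_iff Bex_def)
  have B: "{h. realizes_depth P p h} = hyperplane_at p ` {v \<in> sphere 0 1. depth p P = cut_fraction P p v}"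
    unfolding realizes_depth_def by auto
  show ?thesis
    unfolding A B direction_affine_image[OF assms] image_image by auto
qed

lemma max_depth_point_affine_image:
  fixes L :: "real^'n::{finite,wellorder} \<Rightarrow> real^'n::_"
  assumes "linear L" "inj L" "compact P"
  assumes "max_depth_point ((\<lambda>x. q + L x) ` P) (q + L p)"
  shows "max_depth_point P p"
proof -
  have "interior ((\<lambda>x. q + L x) ` P) = (\<lambda>x. q + L x) ` interior P"
    using interior_translation[of q "L ` P"] interior_injective_linear_image[OF assms(1,2), of P]
    by (simp add: image_image)
  moreover have "inj (\<lambda>x. q + L x)"
    using assms(2) by (simp add: inj_def)
  then have "q + L p \<in> (\<lambda>x. q + L x) ` interior P \<longleftrightarrow> p \<in> interior P"
    using inj_image_mem_iff by fast
  ultimately show ?thesis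
    using assms(4) unfolding max_depth_point_def
    by (simp add: depth_affine_image[OF assms(1-3)])
qed

lemma barycenter_affine_image:
  fixes L :: "real^'n::{finite,wellorder} \<Rightarrow> real^'n::_"
  assumes L: "linear L" "inj L" "compact P" and pos: "measure lebesgue P \<noteq> 0"
  shows "barycenter ((\<lambda>x. q + L x) ` P) = q + L (barycenter P)"
proof -
  let ?F = "\<lambda>x. q + L x" and ?d = "\<bar>det (matrix L)\<bar>"
  have P: "P \<in> lmeasurable"
    using L(3) by (rule lmeasurable_compact)
  have d: "?d \<noteq> 0"
    using L(2) det_nz_iff_inj[OF L(1)] by simp
  have lebint: "(LINT x:S|lebesgue. x) = integral S (\<lambda>x. x)" "(\<lambda>x. x) absolutely_integrable_on S"
    if "compact S" for S :: "(real^'n::_) set"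
  proof -
    show *: "(\<lambda>x. x) absolutely_integrable_on S"
      using borel_integrable_compact[OF that continuous_on_id]
      by (simp add: set_integrable_def integrable_completion)
    show "(LINT x:S|lebesgue. x) = integral S (\<lambda>x. x)"
      by (rule set_lebesgue_integral_eq_integral(2)[OF *])
  qed
  have "continuous_on P ?F"
    using L(1) by (intro continuous_intros linear_continuous_on) (simp add: linear_linear)
  then have "compact (?F ` P)"
    using L(3) compact_continuous_image by blast
  note FP = lebint[OF this]
  have bl: "bounded_linear L"
    using L(1) by (simp add: linear_linear)
  have id: "(\<lambda>x. x) integrable_on P"
    using set_lebesgue_integral_eq_integral(1)[OF lebint(2)[OF L(3)]] .
  have intL: "L integrable_on P" "integral P L = L (integral P (\<lambda>x. x))"
    using integrable_linear[OF id bl] integral_linear[OF id bl] by (simp_all add: o_def)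
  have one: "(\<lambda>x. 1::real) integrable_on P"
    using P lmeasurable_iff_integrable_on by blast
  have intq: "(\<lambda>x. q) integrable_on P" "integral P (\<lambda>x. q) = measure lebesgue P *\<^sub>R q"
    using integrable_linear[OF one bounded_linear_scaleR_left[of q]]
      integral_linear[OF one bounded_linear_scaleR_left[of q]] lmeasure_integral[OF P]
    by (simp_all add: o_def)
  have der: "(?F has_derivative L) (at x within P)" for x
    using L(1) by (auto intro!: derivative_eq_intros linear_imp_has_derivative)
  have "inj_on ?F P"
    using L(2) by (simp add: inj_on_def)
  then have "integral (?F ` P) (\<lambda>x. x) = integral P (\<lambda>x. ?d *\<^sub>R ?F x)"
    using integral_change_of_variables[OF fmeasurableD[OF P] der, of "\<lambda>x. x"] FP(2) by blast
  also have "\<dots> = ?d *\<^sub>R (integral P (\<lambda>x. q) + integral P L)"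
    by (simp add: integral_add[OF intq(1) intL(1)])
  finally show ?thesis
    using d pos by (simp add: barycenter_def FP lebint[OF L(3)] measure_affine_image[OF L(1) P]
        linear_scale[OF L(1)] intL intq algebra_simps)
qed

section \<open>Sections of a triangle\<close>

lemma content_triangle_corner:
  fixes A B C :: "real^2"
  assumes "\<rho> \<ge> 0" "\<sigma> \<ge> 0"
  shows "measure lborel (convex hull {A, A + \<rho> *\<^sub>R (B - A), A + \<sigma> *\<^sub>R (C - A)})
           = \<rho> * \<sigma> * measure lborel (convex hull {A, B, C})"
proof -
  have "(\<sigma> * (C $ 1 - A $ 1)) * (\<rho> * (B $ 2 - A $ 2)) - (\<rho> * (B $ 1 - A $ 1)) * (\<sigma> * (C $ 2 - A $ 2))
    = (\<rho> * \<sigma>) * ((C $ 1 - A $ 1) * (B $ 2 - A $ 2) - (B $ 1 - A $ 1) * (C $ 2 - A $ 2))"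
    by (simp add: algebra_simps)
  then show ?thesis
    using assms by (simp add: content_triangle abs_mult)
qed

text \<open>By linear interpolation the level line \<open>w \<bullet> x = t\<close> meets the sides \<open>A B\<close> and \<open>A C\<close>
  at the fractions \<open>\<rho>\<close> and \<open>\<sigma>\<close> of their lengths; hence the area of the corner cut off at \<open>A\<close>
  is \<open>\<rho> * \<sigma>\<close> times that of the triangle.\<close>

lemma triangle_halfspace_eq_corner:
  fixes A B C w :: "'a::real_inner"
  assumes "t < w \<bullet> A" "w \<bullet> B \<le> t" "w \<bullet> C \<le> t"
  defines "\<rho> \<equiv> (w \<bullet> A - t) / (w \<bullet> A - w \<bullet> B)" and "\<sigma> \<equiv> (w \<bullet> A - t) / (w \<bullet> A - w \<bullet> C)"
  shows "{x \<in> convex hull {A, B, C}. t \<le> w \<bullet> x}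
           = convex hull {A, A + \<rho> *\<^sub>R (B - A), A + \<sigma> *\<^sub>R (C - A)}" (is "?L = ?R")
proof (intro equalityI subsetI)
  have pos: "0 < \<rho>" "\<rho> \<le> 1" "0 < \<sigma>" "\<sigma> \<le> 1"
    using assms by (auto simp: field_simps)
  have lam: "\<rho> * (w \<bullet> A - w \<bullet> B) = w \<bullet> A - t" "\<sigma> * (w \<bullet> A - w \<bullet> C) = w \<bullet> A - t"
    using assms by auto
  {
    fix x assume "x \<in> ?L"
    then obtain a b c where abc: "0 \<le> a" "0 \<le> b" "0 \<le> c" "a + b + c = 1"
        "x = a *\<^sub>R A + b *\<^sub>R B + c *\<^sub>R C" and t: "t \<le> w \<bullet> x"
      by (auto simp: convex_hull_3)
    have a: "a = 1 - b - c"
      using abc by simp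
    \<comment> \<open>\<open>b / \<rho>\<close> and \<open>c / \<sigma>\<close> are the barycentric coordinates of \<open>x\<close> in the corner triangle.\<close>
    have "(b / \<rho>) * (w \<bullet> A - t) = b * (w \<bullet> A - w \<bullet> B)"
      using pos by (simp add: lam(1)[symmetric])
    moreover have "(c / \<sigma>) * (w \<bullet> A - t) = c * (w \<bullet> A - w \<bullet> C)"
      using pos by (simp add: lam(2)[symmetric])
    ultimately have "(b / \<rho> + c / \<sigma>) * (w \<bullet> A - t) = w \<bullet> A - w \<bullet> x"
      unfolding abc(5) a distrib_right by (simp add: inner_simps algebra_simps)
    also have "\<dots> \<le> 1 * (w \<bullet> A - t)"
      using t by simp
    finally have "b / \<rho> + c / \<sigma> \<le> 1"
      using assms(1) by (simp only: mult_le_cancel_right)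
    moreover have "x = (1 - b / \<rho> - c / \<sigma>) *\<^sub>R A + (b / \<rho>) *\<^sub>R (A + \<rho> *\<^sub>R (B - A))
        + (c / \<sigma>) *\<^sub>R (A + \<sigma> *\<^sub>R (C - A))"
      unfolding abc(5) a using pos by (simp add: algebra_simps)
    ultimately show "x \<in> ?R"
      unfolding convex_hull_3 using abc pos
      by (intro CollectI exI[of _ "1 - b / \<rho> - c / \<sigma>"] exI[of _ "b / \<rho>"] exI[of _ "c / \<sigma>"]) auto
  next
    fix x assume "x \<in> ?R"
    moreover have "convex ?L"
    proof -
      have "?L = convex hull {A, B, C} \<inter> {x. w \<bullet> x \<ge> t}"
        by auto
      then show ?thesis
        using convex_Int[OF convex_convex_hull convex_halfspace_ge] by simp
    qed
    moreover have "A + \<rho> *\<^sub>R (B - A) \<in> convex hull {A, B, C}"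
      unfolding convex_hull_3 using pos
      by (intro CollectI exI[of _ "1 - \<rho>"] exI[of _ \<rho>] exI[of _ 0]) (auto simp: algebra_simps)
    moreover have "A + \<sigma> *\<^sub>R (C - A) \<in> convex hull {A, B, C}"
      unfolding convex_hull_3 using pos
      by (intro CollectI exI[of _ "1 - \<sigma>"] exI[of _ 0] exI[of _ \<sigma>]) (auto simp: algebra_simps)
    moreover have "A \<in> convex hull {A, B, C}"
      by (simp add: hull_inc)
    moreover have "w \<bullet> (A + \<rho> *\<^sub>R (B - A)) = t" "w \<bullet> (A + \<sigma> *\<^sub>R (C - A)) = t"
      using lam by (simp_all add: inner_simps algebra_simps)
    ultimately show "x \<in> ?L"
      using hull_minimal[of "{A, A + \<rho> *\<^sub>R (B - A), A + \<sigma> *\<^sub>R (C - A)}" ?L convex] assms(1)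
      by auto
  }
qed

definition upper_area :: "real^2 \<Rightarrow> (real^2) set \<Rightarrow> real \<Rightarrow> real" where
  "upper_area w T t = measure lborel {x \<in> T. t \<le> w \<bullet> x}"

lemma upper_area_corner:
  assumes "t < w \<bullet> A" "w \<bullet> B \<le> t" "w \<bullet> C \<le> t"
  shows "upper_area w (convex hull {A, B, C}) t
    = (w \<bullet> A - t)\<^sup>2 / ((w \<bullet> A - w \<bullet> B) * (w \<bullet> A - w \<bullet> C)) * measure lborel (convex hull {A, B, C})"
  using assms by (simp add: upper_area_def triangle_halfspace_eq_corner content_triangle_corner
      power2_eq_square)

lemma upper_area_whole:
  assumes "t \<le> w \<bullet> A" "t \<le> w \<bullet> B" "t \<le> w \<bullet> C"
  shows "upper_area w (convex hull {A, B, C}) t = measure lborel (convex hull {A, B, C})"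
proof -
  have "convex hull {A, B, C} \<subseteq> {x. w \<bullet> x \<ge> t}"
    using assms by (intro hull_minimal convex_halfspace_ge) auto
  then have "{x \<in> convex hull {A, B, C}. t \<le> w \<bullet> x} = convex hull {A, B, C}"
    by auto
  then show ?thesis
    by (simp add: upper_area_def)
qed

text \<open>With two vertices above the level, the part below the level is the corner at the third vertex.
  The inequality is enough for the lower bounds below, and it spares the argument that the level line
  is a null set.\<close>

lemma upper_area_ge_complement_corner:
  assumes "w \<bullet> C < t" "t \<le> w \<bullet> A" "t \<le> w \<bullet> B"
  shows "(1 - (t - w \<bullet> C)\<^sup>2 / ((w \<bullet> A - w \<bullet> C) * (w \<bullet> B - w \<bullet> C))) * measure lborel (convex hull {A, B, C})
    \<le> upper_area w (convex hull {A, B, C}) t"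
proof -
  let ?T = "convex hull {A, B, C}"
  have comp: "compact ?T"
    by (simp add: finite_imp_compact_convex_hull)
  have eq: "{x \<in> ?T. t \<le> u \<bullet> x} = ?T \<inter> {x. u \<bullet> x \<ge> t}" for u t
    by auto
  have fm: "{x \<in> ?T. t \<le> u \<bullet> x} \<in> fmeasurable lborel" for u t
    unfolding eq by (intro fmeasurable_compact compact_Int_closed comp closed_halfspace_ge)
  have "measure lborel ({x \<in> ?T. t \<le> w \<bullet> x} \<union> {x \<in> ?T. - t \<le> (- w) \<bullet> x})
      \<le> upper_area w ?T t + upper_area (- w) ?T (- t)"
    unfolding upper_area_def by (rule measure_Un_le[OF fmeasurableD fmeasurableD, OF fm fm])
  moreover have "{x \<in> ?T. t \<le> w \<bullet> x} \<union> {x \<in> ?T. - t \<le> (- w) \<bullet> x} = ?T"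
    by auto
  ultimately have "measure lborel ?T \<le> upper_area w ?T t + upper_area (- w) ?T (- t)"
    by simp
  moreover have "upper_area (- w) (convex hull {C, A, B}) (- t)
    = (t - w \<bullet> C)\<^sup>2 / ((w \<bullet> A - w \<bullet> C) * (w \<bullet> B - w \<bullet> C)) * measure lborel (convex hull {C, A, B})"
    using assms by (subst upper_area_corner) (auto simp: power2_commute)
  moreover have "{C, A, B} = {A, B, C}"
    by auto
  ultimately show ?thesis
    by (simp add: algebra_simps)
qed

text \<open>The next five inequalities are the cases of \<open>upper_area_opposite_levels_sorted\<close>. Relative to its
  mean, \<open>w\<close> has the values
  \<open>m + n, - m, - n\<close> at the vertices when one vertex lies above the mean, and \<open>n, m, - (m + n)\<close> when two
  do, with \<open>m \<le> n\<close>; the summands bound the area fractions above the levels \<open>t\<close> and \<open>- t\<close> from below, and the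
  cases differ in which corners these two levels cut off.\<close>

lemma one_vertex_above_near:
  fixes m n t :: real
  assumes "0 < t" "t < m" "m \<le> n"
  shows "8/9 < (m + n - t)\<^sup>2 / ((2 * m + n) * (m + 2 * n)) + (m + n + t)\<^sup>2 / ((2 * m + n) * (m + 2 * n))"
proof -
  have "9 * ((m + n - t)\<^sup>2 + (m + n + t)\<^sup>2) - (2 * m + n) * (m + 2 * n) * 8 = 2 * (m - n)\<^sup>2 + 18 * t\<^sup>2"
    by (simp add: power2_eq_square algebra_simps)
  moreover have "0 < t\<^sup>2" "0 \<le> (m - n)\<^sup>2"
    using assms by simp_all
  ultimately have "(2 * m + n) * (m + 2 * n) * 8 < 9 * ((m + n - t)\<^sup>2 + (m + n + t)\<^sup>2)"
    by linarith
  moreover have "0 < (2 * m + n) * (m + 2 * n)"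
    using assms by simp
  ultimately show ?thesis
    by (simp add: add_divide_distrib[symmetric] field_simps)
qed

lemma one_vertex_above_middle:
  fixes m n t :: real
  assumes "0 \<le> m" "m < t" "t < n"
  shows "8/9 < (m + n - t)\<^sup>2 / ((2 * m + n) * (m + 2 * n)) + (1 - (n - t)\<^sup>2 / ((m + 2 * n) * (n - m)))"
proof -
  \<comment> \<open>In terms of \<open>m\<close>, \<open>u\<close>, \<open>p\<close>, the numerator of the difference is visibly positive because \<open>u < p\<close>.\<close>
  define u p where "u = n - t" and "p = n - m"
  have up: "0 < u" "u < p" "n = m + p" "t = m + p - u"
    using assms by (auto simp: u_def p_def)
  have pos: "0 < 3 * m + p" "0 < 3 * m + 2 * p" "0 < p"
    using up assms by auto
  have "(m + u)\<^sup>2 / ((3 * m + p) * (3 * m + 2 * p)) + (1 - u\<^sup>2 / ((3 * m + 2 * p) * p)) - 8/9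
    = (18 * m\<^sup>2 * p + 2 * p ^ 3 + 9 * m * ((p - u) * (p + 3 * u))) / (9 * p * (3 * m + p) * (3 * m + 2 * p))"
    using pos by (simp add: divide_simps) (simp add: power2_eq_square power3_eq_cube algebra_simps)
  also have "\<dots> > 0"
    using up pos assms by (intro divide_pos_pos add_pos_nonneg add_nonneg_pos) auto
  finally show ?thesis
    unfolding up(3,4) by (simp add: algebra_simps)
qed

lemma two_vertices_above_near:
  fixes m n t :: real
  assumes "0 < t" "t < m" "m \<le> n"
  shows "8/9 < (1 - (m + n + t)\<^sup>2 / ((2 * n + m) * (2 * m + n))) + (1 - (m + n - t)\<^sup>2 / ((2 * n + m) * (2 * m + n)))"
proof -
  have "t * t < m * m" "m * m \<le> n * n" "m * m \<le> m * n"
    using assms by (auto intro!: mult_strict_mono mult_mono)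
  moreover have "0 < (2 * n + m) * (2 * m + n)"
    using assms by simp
  moreover have "9 * ((m + n + t)\<^sup>2 + (m + n - t)\<^sup>2) < 10 * ((2 * n + m) * (2 * m + n))"
    using calculation by (simp add: power2_eq_square algebra_simps)
  ultimately have "((m + n + t)\<^sup>2 + (m + n - t)\<^sup>2) / ((2 * n + m) * (2 * m + n)) < 10/9"
    by (simp add: pos_divide_less_eq)
  then show ?thesis
    by (simp add: add_divide_distrib)
qed

lemma two_vertices_above_middle:
  fixes m n t :: real
  assumes "0 < m" "m < t" "t < n"
  shows "8/9 < (n - t)\<^sup>2 / ((n - m) * (2 * n + m)) + (1 - (m + n - t)\<^sup>2 / ((2 * n + m) * (2 * m + n)))"
proof -
  \<comment> \<open>The numerator of the difference is now a cube plus \<open>9 * m\<close> times a sum of squares.\<close>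
  define u p where "u = n - t" and "p = n - m"
  have up: "0 < u" "u < p" "n = m + p" "t = m + p - u"
    using assms by (auto simp: u_def p_def)
  have pos: "0 < 3 * m + p" "0 < 3 * m + 2 * p" "0 < p"
    using up assms by auto
  have "u\<^sup>2 / (p * (3 * m + 2 * p)) + (1 - (m + u)\<^sup>2 / ((3 * m + 2 * p) * (3 * m + p))) - 8/9
    = (2 * p ^ 3 + 9 * m * ((p - u)\<^sup>2 + 2 * u\<^sup>2)) / (9 * p * (3 * m + p) * (3 * m + 2 * p))"
    using pos by (simp add: divide_simps) (simp add: power2_eq_square power3_eq_cube algebra_simps)
  also have "\<dots> > 0"
    using up pos assms by (intro divide_pos_pos add_pos_nonneg add_nonneg_pos) auto
  finally show ?thesis
    unfolding up(3,4) by (simp add: algebra_simps)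
qed

lemma two_vertices_above_far:
  fixes m n t :: real
  assumes "0 < m" "m \<le> n" "n < t" "t < m + n"
  shows "8/9 < 1 - (m + n - t)\<^sup>2 / ((2 * n + m) * (2 * m + n))"
proof -
  have "(m + n - t)\<^sup>2 < m\<^sup>2"
    using assms by (intro power_strict_mono) auto
  moreover have "m * m \<le> n * n" "m * m \<le> m * n"
    using assms by (auto intro!: mult_mono)
  moreover have "0 < (2 * n + m) * (2 * m + n)"
    using assms by simp
  moreover have "9 * (m + n - t)\<^sup>2 < (2 * n + m) * (2 * m + n)"
    using calculation by (simp add: power2_eq_square algebra_simps)
  ultimately have "(m + n - t)\<^sup>2 / ((2 * n + m) * (2 * m + n)) < 1/9"
    by (simp add: pos_divide_less_eq)
  then show ?thesis by simp
qed

lemma upper_area_nonneg: "0 \<le> upper_area w T t"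
  by (simp add: upper_area_def)

text \<open>The bound is sharp: if \<open>w\<close> has the values \<open>n, n, - 2 * n\<close> relative to its mean, the levels \<open>n\<close>
  and \<open>- n\<close> leave the fractions \<open>0\<close> and \<open>8/9\<close> above them. Such coincidences of a level with a vertex
  are excluded, which makes the inequality strict and loses only finitely many levels.\<close>

lemma upper_area_opposite_levels_sorted:
  fixes A B C w :: "real^2"
  defines "T \<equiv> convex hull {A, B, C}" and "c \<equiv> (w \<bullet> A + w \<bullet> B + w \<bullet> C) / 3"
  assumes T: "0 < measure lborel T" and t: "0 < t"
    and generic: "t \<notin> {\<bar>w \<bullet> A - c\<bar>, \<bar>w \<bullet> B - c\<bar>, \<bar>w \<bullet> C - c\<bar>}"
    and sorted: "w \<bullet> B \<le> w \<bullet> A" "w \<bullet> C \<le> w \<bullet> B"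
  shows "8/9 * measure lborel T < upper_area w T (c + t) + upper_area w T (c - t)"
proof -
  let ?U = "upper_area w T" and ?M = "measure lborel T"
  note corner = upper_area_corner[of _ w A B C, folded T_def]
    and cocorner = upper_area_ge_complement_corner[of w C _ A B, folded T_def]
    and whole = upper_area_whole[of _ w A B C, folded T_def]
  have sum: "w \<bullet> A + w \<bullet> B + w \<bullet> C = 3 * c"
    by (simp add: c_def)
  have combine: ?thesis if "8/9 < x + y" "x * ?M \<le> ?U (c + t)" "y * ?M \<le> ?U (c - t)" for x y
    using mult_strict_right_mono[OF that(1) T] that(2,3) by (simp add: distrib_right)
  have nonneg: "0 * ?M \<le> ?U s" for s
    by (simp add: upper_area_nonneg)
  show ?thesis
  proof (cases "w \<bullet> B \<le> c")
    case True
    define m n where "m = c - w \<bullet> B" and "n = c - w \<bullet> C"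
    have mn: "w \<bullet> A = c + m + n" "w \<bullet> B = c - m" "w \<bullet> C = c - n" "0 \<le> m" "m \<le> n"
      using True sorted sum by (auto simp: m_def n_def)
    have "t \<noteq> m" "t \<noteq> n"
      using generic mn by auto
    then consider "t < m" | "m < t" "t < n" | "n < t"
      by linarith
    then show ?thesis
    proof cases
      case 1
      show ?thesis
        using combine[OF one_vertex_above_near[OF t 1 mn(5)]] corner[of "c + t"] corner[of "c - t"] mn 1 t
        by (simp add: algebra_simps)
    next
      case 2
      show ?thesis
        using combine[OF one_vertex_above_middle[OF mn(4) 2]] corner[of "c + t"] cocorner[of "c - t"] mn 2 t
        by (simp add: algebra_simps)
    next
      case 3
      then show ?thesis
        using combine[of 0 1] nonneg[of "c + t"] whole[of "c - t"] mn t by simp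
    qed
  next
    case False
    define m n where "m = w \<bullet> B - c" and "n = w \<bullet> A - c"
    have mn: "w \<bullet> A = c + n" "w \<bullet> B = c + m" "w \<bullet> C = c - (m + n)" "0 < m" "m \<le> n"
      using False sorted sum by (auto simp: m_def n_def)
    have "t \<noteq> m" "t \<noteq> n" "t \<noteq> m + n"
      using generic mn by auto
    then consider "t < m" | "m < t" "t < n" | "n < t" "t < m + n" | "m + n < t"
      by linarith
    then show ?thesis
    proof cases
      case 1
      show ?thesis
        using combine[OF two_vertices_above_near[OF t 1 mn(5)]] cocorner[of "c + t"] cocorner[of "c - t"] mn 1 t
        by (simp add: algebra_simps)
    next
      case 2
      show ?thesis
        using combine[OF two_vertices_above_middle[OF mn(4) 2]] corner[of "c + t"] cocorner[of "c - t"] mn 2 t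
        by (simp add: algebra_simps)
    next
      case 3
      show ?thesis
        using combine[of 0 "1 - (m + n - t)\<^sup>2 / ((2 * n + m) * (2 * m + n))"] nonneg[of "c + t"]
          two_vertices_above_far[OF mn(4,5) 3] cocorner[of "c - t"] mn 3 t
        by (simp add: algebra_simps)
    next
      case 4
      then show ?thesis
        using combine[of 0 1] nonneg[of "c + t"] whole[of "c - t"] mn t by simp
    qed
  qed
qed

text \<open>This is Winternitz's inequality for the triangle. With one vertex above the mean and values
  \<open>m + n, - m, - n\<close>, the fraction is \<open>(m + n)\<^sup>2 / (2 * (m + n)\<^sup>2 + m * n)\<close>, which is least for \<open>m = n\<close>.
  With two vertices above, the complement is such a corner and has fraction at most \<open>1/2\<close>.\<close>

lemma upper_area_through_centroid_sorted:
  fixes A B C w :: "real^2"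
  defines "T \<equiv> convex hull {A, B, C}" and "c \<equiv> (w \<bullet> A + w \<bullet> B + w \<bullet> C) / 3"
  assumes T: "0 < measure lborel T"
    and sorted: "w \<bullet> B \<le> w \<bullet> A" "w \<bullet> C \<le> w \<bullet> B"
  shows "4/9 * measure lborel T < upper_area w T c \<or>
         upper_area w T c = 4/9 * measure lborel T \<and> w \<bullet> B = w \<bullet> C"
proof -
  let ?U = "upper_area w T" and ?M = "measure lborel T"
  note corner = upper_area_corner[of _ w A B C, folded T_def]
    and cocorner = upper_area_ge_complement_corner[of w C _ A B, folded T_def]
    and whole = upper_area_whole[of _ w A B C, folded T_def]
  have sum: "w \<bullet> A + w \<bullet> B + w \<bullet> C = 3 * c"
    by (simp add: c_def)
  have combine: ?thesis if "4/9 < x" "x * ?M \<le> ?U c" for x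
    using mult_strict_right_mono[OF that(1) T] that(2) by simp
  show ?thesis
  proof (cases "w \<bullet> B \<le> c")
    case True
    define m n where "m = c - w \<bullet> B" and "n = c - w \<bullet> C"
    have mn: "w \<bullet> A = c + m + n" "w \<bullet> B = c - m" "w \<bullet> C = c - n" "0 \<le> m" "m \<le> n"
      using True sorted sum by (auto simp: m_def n_def)
    show ?thesis
    proof (cases "n = 0")
      case True
      then show ?thesis
        using combine[of 1] whole[of c] mn by simp
    next
      case False
      then have U: "?U c = (m + n)\<^sup>2 / ((2 * m + n) * (m + 2 * n)) * ?M"
        using corner[of c] mn by (simp add: algebra_simps)
      have D: "(2 * m + n) * (m + 2 * n) > 0"
        using mn False by simp
      show ?thesis
      proof (cases "m = n")
        case True
        have "(m + n)\<^sup>2 / ((2 * m + n) * (m + 2 * n)) = 4/9"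
          using True False by (simp add: field_simps power2_eq_square)
        then have "?U c = 4/9 * ?M"
          unfolding U by (simp only:)
        then show ?thesis
          using True mn by simp
      next
        case ne: False
        then have "0 < (n - m)\<^sup>2"
          by simp
        then have "4/9 * ((2 * m + n) * (m + 2 * n)) < (m + n)\<^sup>2"
          by (simp add: power2_eq_square algebra_simps)
        then have "4/9 < (m + n)\<^sup>2 / ((2 * m + n) * (m + 2 * n))"
          using D by (simp only: pos_less_divide_eq)
        from combine[OF this] show ?thesis
          unfolding U by simp
      qed
    qed
  next
    case False
    define m n where "m = w \<bullet> B - c" and "n = w \<bullet> A - c"
    have mn: "w \<bullet> A = c + n" "w \<bullet> B = c + m" "w \<bullet> C = c - (m + n)" "0 < m" "m \<le> n"
      using False sorted sum by (auto simp: m_def n_def)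
    have D: "(2 * n + m) * (2 * m + n) > 0"
      using mn by simp
    have "0 < m * m + (n * n + m * (n * 7))"
      using mn by (intro add_pos_pos mult_pos_pos) auto
    then have "9 * (m + n)\<^sup>2 < 5 * ((2 * n + m) * (2 * m + n))"
      by (simp add: power2_eq_square algebra_simps)
    then have "4/9 < 1 - (m + n)\<^sup>2 / ((2 * n + m) * (2 * m + n))"
      using D by (simp add: field_simps)
    from combine[OF this] show ?thesis
      using cocorner[of c] mn by (simp add: algebra_simps)
  qed
qed

lemma sorted_triple_cases:
  fixes f :: "'a \<Rightarrow> real"
  assumes "\<And>A B C. {A, B, C} = {X, Y, Z} \<Longrightarrow> f A + f B + f C = f X + f Y + f Z \<Longrightarrow> f B \<le> f A \<Longrightarrow> f C \<le> f B \<Longrightarrow> P"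
  shows P
proof -
  consider "f Y \<le> f X" "f Z \<le> f Y" | "f Z \<le> f X" "f Y \<le> f Z" | "f X \<le> f Y" "f Z \<le> f X"
    | "f Z \<le> f Y" "f X \<le> f Z" | "f X \<le> f Z" "f Y \<le> f X" | "f Y \<le> f Z" "f X \<le> f Y"
    by linarith
  then show P
    by cases (use assms[of X Y Z] assms[of X Z Y] assms[of Y X Z] assms[of Y Z X] assms[of Z X Y]
      assms[of Z Y X] in \<open>auto simp: insert_commute\<close>)
qed

lemma upper_area_opposite_levels:
  fixes A B C w :: "real^2"
  defines "T \<equiv> convex hull {A, B, C}" and "c \<equiv> (w \<bullet> A + w \<bullet> B + w \<bullet> C) / 3"
  assumes T: "0 < measure lborel T" and t: "0 < t"
    and generic: "t \<notin> {\<bar>w \<bullet> A - c\<bar>, \<bar>w \<bullet> B - c\<bar>, \<bar>w \<bullet> C - c\<bar>}"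
  shows "8/9 * measure lborel T < upper_area w T (c + t) + upper_area w T (c - t)"
proof (rule sorted_triple_cases[where f = "(\<bullet>) w" and X = A and Y = B and Z = C])
  fix A' B' C' assume eq: "{A', B', C'} = {A, B, C}" "w \<bullet> A' + w \<bullet> B' + w \<bullet> C' = w \<bullet> A + w \<bullet> B + w \<bullet> C"
    and sorted: "w \<bullet> B' \<le> w \<bullet> A'" "w \<bullet> C' \<le> w \<bullet> B'"
  have "t \<notin> (\<lambda>X. \<bar>w \<bullet> X - c\<bar>) ` {A', B', C'}"
    using generic by (subst eq) simp
  then show ?thesis
    using upper_area_opposite_levels_sorted[OF _ t _ sorted, unfolded eq, folded T_def c_def] T by simp
qed

lemma upper_area_through_centroid:
  fixes A B C w :: "real^2"
  defines "T \<equiv> convex hull {A, B, C}" and "c \<equiv> (w \<bullet> A + w \<bullet> B + w \<bullet> C) / 3"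
  assumes T: "0 < measure lborel T"
  shows "4/9 * measure lborel T < upper_area w T c \<or> upper_area w T c = 4/9 * measure lborel T \<and>
     (w \<bullet> B = w \<bullet> C \<or> w \<bullet> C = w \<bullet> A \<or> w \<bullet> A = w \<bullet> B)"
proof (rule sorted_triple_cases[where f = "(\<bullet>) w" and X = A and Y = B and Z = C])
  fix A' B' C' assume eq: "{A', B', C'} = {A, B, C}" "w \<bullet> A' + w \<bullet> B' + w \<bullet> C' = w \<bullet> A + w \<bullet> B + w \<bullet> C"
    and sorted: "w \<bullet> B' \<le> w \<bullet> A'" "w \<bullet> C' \<le> w \<bullet> B'"
  have "{w \<bullet> A', w \<bullet> B', w \<bullet> C'} = {w \<bullet> A, w \<bullet> B, w \<bullet> C}"
    using arg_cong[OF eq(1), of "image ((\<bullet>) w)"] by simp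
  then have "\<forall>y \<in> {w \<bullet> A, w \<bullet> B, w \<bullet> C}. y = w \<bullet> A' \<or> y = w \<bullet> B'" if "w \<bullet> B' = w \<bullet> C'"
    using that by (metis insertE singletonD)
  then have "w \<bullet> B = w \<bullet> C \<or> w \<bullet> C = w \<bullet> A \<or> w \<bullet> A = w \<bullet> B" if "w \<bullet> B' = w \<bullet> C'"
    using that by (metis insert_iff)
  then show ?thesis
    using upper_area_through_centroid_sorted[OF _ sorted, unfolded eq, folded T_def c_def] T by blast
qed

section \<open>Integration over slices\<close>

lemma prod_Basis_cart:
  fixes x :: "real^'n"
  shows "(\<Prod>b\<in>Basis. x \<bullet> b) = (\<Prod>i\<in>UNIV. x $ i)"
proof -
  have B: "(Basis :: (real^'n) set) = range (\<lambda>i. axis i 1)"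
    by (auto simp: Basis_vec_def)
  have "inj (\<lambda>i::'n. axis i (1::real))"
    by (auto simp: inj_def axis_eq_axis)
  from prod.reindex[OF this, of "(\<bullet>) x"] show ?thesis
    unfolding B by (simp add: inner_axis)
qed

text \<open>Cavalieri's principle for the third coordinate: the map \<open>(s, x) \<mapsto> (x\<^sub>1, x\<^sub>2, s)\<close> preserves the
  volume of boxes, hence Lebesgue measure, and Fubini's theorem applies on the product side.\<close>

lemma emeasure_lborel_real3_slices:
  fixes D :: "(real^3) set"
  assumes D: "D \<in> sets borel"
  shows "emeasure lborel D = (\<integral>\<^sup>+s. emeasure lborel {x::real^2. vector [x $ 1, x $ 2, s] \<in> D} \<partial>lborel)"
    and "(\<lambda>s. emeasure lborel {x::real^2. vector [x $ 1, x $ 2, s] \<in> D}) \<in> borel_measurable borel"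
proof -
  define f :: "real \<times> (real^2) \<Rightarrow> real^3" where "f = (\<lambda>(s, x). vector [x $ 1, x $ 2, s])"
  have "f = (\<lambda>z. (snd z $ 1) *\<^sub>R axis 1 1 + (snd z $ 2) *\<^sub>R axis 2 1 + fst z *\<^sub>R axis 3 1)"
    by (auto simp: f_def fun_eq_iff vec_eq_iff forall_3 axis_def)
  then have "continuous_on UNIV f"
    by (auto intro!: continuous_intros)
  then have f: "f \<in> borel_measurable borel"
    by (rule borel_measurable_continuous_onI)
  then have f': "f \<in> measurable (lborel \<Otimes>\<^sub>M lborel) borel"
    unfolding lborel_prod by simp
  have "lborel = distr (lborel \<Otimes>\<^sub>M lborel) borel f"
  proof (rule lborel_eqI)
    fix l u :: "real^3" assume lu: "\<And>b. b \<in> Basis \<Longrightarrow> l \<bullet> b \<le> u \<bullet> b"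
    then have le: "l $ i \<le> u $ i" for i
      using lu[of "axis i 1"] by (simp add: inner_axis axis_in_Basis_iff)
    let ?l = "vector [l $ 1, l $ 2] :: real^2" and ?u = "vector [u $ 1, u $ 2] :: real^2"
    have "\<forall>i. ?l $ i \<le> ?u $ i"
      using le by (simp add: forall_2)
    then have box_le: "?l \<bullet> b \<le> ?u \<bullet> b" if "b \<in> Basis" for b
      using that by (auto simp: Basis_vec_def inner_axis)
    have eq: "f -` box l u = {l $ 3<..<u $ 3} \<times> box ?l ?u"
      by (auto simp: f_def mem_box_cart forall_3 forall_2)
    have "box l u \<in> sets borel"
      by simp
    then have "emeasure (distr (lborel \<Otimes>\<^sub>M lborel) borel f) (box l u)
      = emeasure (lborel \<Otimes>\<^sub>M lborel) ({l $ 3<..<u $ 3} \<times> box ?l ?u)"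
      using emeasure_distr[OF f'] by (simp add: eq space_pair_measure)
    also have "\<dots> = emeasure lborel {l $ 3<..<u $ 3} * emeasure lborel (box ?l ?u)"
      by (intro lborel.emeasure_pair_measure_Times) auto
    also have "\<dots> = ennreal (u $ 3 - l $ 3) * ennreal (\<Prod>i\<in>UNIV. (?u - ?l) $ i)"
      using le box_le emeasure_lborel_box[of ?l ?u, unfolded prod_Basis_cart] by simp
    also have "\<dots> = ennreal (\<Prod>b\<in>Basis. (u - l) \<bullet> b)"
    proof -
      have "(\<Prod>i\<in>UNIV. (?u - ?l) $ i) = (u $ 1 - l $ 1) * (u $ 2 - l $ 2)"
        unfolding UNIV_2 by simp
      moreover have "(\<Prod>i\<in>UNIV. (u - l) $ i) = (u $ 1 - l $ 1) * (u $ 2 - l $ 2) * (u $ 3 - l $ 3)"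
        unfolding UNIV_3 by simp
      ultimately show ?thesis
        using le[of 3] unfolding prod_Basis_cart by (simp only: ennreal_mult'[symmetric] mult.commute diff_ge_0_iff_ge)
    qed
    finally show "emeasure (distr (lborel \<Otimes>\<^sub>M lborel) borel f) (box l u) = (\<Prod>b\<in>Basis. (u - l) \<bullet> b)" .
  qed simp
  moreover have sets: "f -` D \<in> sets (lborel \<Otimes>\<^sub>M lborel)"
    using measurable_sets[OF f' D] by (simp add: space_pair_measure)
  ultimately have "emeasure lborel D = emeasure (lborel \<Otimes>\<^sub>M lborel) (f -` D)"
    using emeasure_distr[OF f' D] by (simp add: space_pair_measure)
  then show "emeasure lborel D = (\<integral>\<^sup>+s. emeasure lborel {x::real^2. vector [x $ 1, x $ 2, s] \<in> D} \<partial>lborel)"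
    unfolding lborel.emeasure_pair_measure_alt[OF sets] by (simp add: f_def vimage_def)
  show "(\<lambda>s. emeasure lborel {x::real^2. vector [x $ 1, x $ 2, s] \<in> D}) \<in> borel_measurable borel"
    using lborel.measurable_emeasure_Pair[OF sets] by (simp add: f_def vimage_def)
qed

text \<open>Averaging over the heights \<open>s\<close> and \<open>- s\<close> together: a bound for the pair of slices bounds the volume,
  since the integral of \<open>U\<close> is half the integral of \<open>U s + U (- s)\<close> over an interval of length \<open>2\<close>.\<close>

lemma set_integral_reflection_gt:
  fixes U :: "real \<Rightarrow> real"
  assumes U: "set_integrable lborel {-1..1} U"
    and gt: "AE s in lborel. s \<in> {-1..1} \<longrightarrow> k < U s + U (- s)"
  shows "k < (LINT s:{-1..1}|lborel. U s)"
proof -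
  have "(\<lambda>s. indicator {-1..1} (0 + - 1 * s) *\<^sub>R U (0 + - 1 * s)) = (\<lambda>s. indicator {-1..1} s *\<^sub>R U (- s))"
    by (auto simp: indicator_def fun_eq_iff)
  then have "set_integrable lborel {-1..1} (\<lambda>s. U (- s))"
    using lborel_integrable_real_affine[OF U[unfolded set_integrable_def], of "-1" 0]
    unfolding set_integrable_def by simp
  note int = U this
  have k: "set_integrable lborel {-1..1} (\<lambda>s::real. k)"
    by (simp add: set_integrable_def)
  define f where "f = (\<lambda>s. indicator {-1..1} s * (U s + U (- s) - k))"
  have f: "integrable lborel f"
    using set_integral_diff(1)[OF set_integral_add(1)[OF int] k] by (simp add: f_def set_integrable_def)
  have "integral\<^sup>L lborel f = (LINT s:{-1..1}|lborel. U s) + (LINT s:{-1..1}|lborel. U (- s)) - 2 * k"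
    using set_integral_diff(2)[OF set_integral_add(1)[OF int] k] set_integral_add(2)[OF int]
    by (simp add: f_def set_lebesgue_integral_def)
  also have "(LINT s:{-1..1}|lborel. U (- s)) = (LINT s:{-1..1}|lborel. U s)"
  proof -
    have "{x. - x \<in> {-1..1}} = {-1..1::real}" by auto
    then show ?thesis
      using set_integral_reflect[of "{-1..1}" U] by simp
  qed
  finally have eq: "integral\<^sup>L lborel f = 2 * (LINT s:{-1..1}|lborel. U s) - 2 * k"
    by simp
  have nonneg: "AE s in lborel. 0 \<le> f s"
    using gt by eventually_elim (auto simp: f_def indicator_def)
  have "integral\<^sup>L lborel f \<noteq> 0"
  proof
    assume "integral\<^sup>L lborel f = 0"
    then have "AE s in lborel. f s = 0"
      using integral_nonneg_eq_0_iff_AE[OF f nonneg] by simp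
    then have "AE s in lborel. s \<notin> {-1..1::real}"
      using gt by eventually_elim (auto simp: f_def)
    then have "emeasure lborel {-1..1::real} = 0"
      by (subst (asm) AE_iff_measurable[of "{-1..1}"]) auto
    then show False
      by simp
  qed
  moreover have "0 \<le> integral\<^sup>L lborel f"
    using nonneg by (rule integral_nonneg_AE)
  ultimately show ?thesis
    using eq by simp
qed

lemma set_integral_reflection_lt:
  fixes U :: "real \<Rightarrow> real"
  assumes U: "set_integrable lborel {-1..1} U"
    and lt: "\<And>s. s \<in> {-1..1} \<Longrightarrow> U s + U (- s) < k"
  shows "(LINT s:{-1..1}|lborel. U s) < k"
proof -
  have "set_integrable lborel {-1..1} (\<lambda>s. - U s)"
    using set_integrable_mult_right[OF U, of "- 1"] by simp
  moreover have "AE s in lborel. s \<in> {-1..1} \<longrightarrow> - k < - U s + - U (- s)"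
    using lt by (intro AE_I2) fastforce
  ultimately have "- k < (LINT s:{-1..1}|lborel. - U s)"
    by (rule set_integral_reflection_gt)
  then show ?thesis
    by (simp add: set_integral_uminus[OF U])
qed

section \<open>The standard prism\<close>

definition prism :: "(real^3) set" where
  "prism = {y. 0 \<le> y $ 1 \<and> 0 \<le> y $ 2 \<and> y $ 1 + y $ 2 \<le> 1 \<and> \<bar>y $ 3\<bar> \<le> 1}"

definition prism_base :: "(real^2) set" where
  "prism_base = convex hull {0, axis 1 1, axis 2 1}"

lemma mem_prism_base: "x \<in> prism_base \<longleftrightarrow> 0 \<le> x $ 1 \<and> 0 \<le> x $ 2 \<and> x $ 1 + x $ 2 \<le> 1"
proof
  assume "x \<in> prism_base"
  then show "0 \<le> x $ 1 \<and> 0 \<le> x $ 2 \<and> x $ 1 + x $ 2 \<le> 1"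
    by (auto simp: prism_base_def convex_hull_3 axis_def)
next
  assume x: "0 \<le> x $ 1 \<and> 0 \<le> x $ 2 \<and> x $ 1 + x $ 2 \<le> 1"
  moreover have "x = (1 - x $ 1 - x $ 2) *\<^sub>R 0 + (x $ 1) *\<^sub>R axis 1 1 + (x $ 2) *\<^sub>R axis 2 1"
    by (simp add: vec_eq_iff forall_2 axis_def)
  ultimately show "x \<in> prism_base"
    unfolding prism_base_def convex_hull_3
    by (intro CollectI exI[of _ "1 - x $ 1 - x $ 2"] exI[of _ "x $ 1"] exI[of _ "x $ 2"]) auto
qed

lemma measure_prism_base: "measure lborel prism_base = 1/2"
  unfolding prism_base_def by (simp add: content_triangle axis_def)

lemma compact_prism: "compact prism"
proof (rule compact_eq_bounded_closed[THEN iffD2])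
  have "closed prism"
    unfolding prism_def by (intro closed_Collect_conj closed_Collect_le continuous_intros)
  moreover have "norm y \<le> 3" if "y \<in> prism" for y
    using norm_le_l1_cart[of y] that by (simp add: prism_def sum_3)
  ultimately show "bounded prism \<and> closed prism"
    by (auto simp: bounded_iff)
qed

text \<open>At height \<open>s\<close> the half-space cuts the base along a line whose direction does not depend on \<open>s\<close>
  and whose level is affine in \<open>s\<close>.\<close>

lemma
  fixes p v :: "real^3"
  defines "U \<equiv> \<lambda>s. upper_area (vector [v $ 1, v $ 2]) prism_base (v \<bullet> p - v $ 3 * s)"
  shows set_integrable_slices: "set_integrable lborel {-1..1} U"
    and measure_halfspace_prism: "measure lebesgue (halfspace_at p v \<inter> prism) = (LINT s:{-1..1}|lborel. U s)"
proof -
  let ?D = "halfspace_at p v \<inter> prism"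
  have "compact ?D"
    by (metis closed_Int_compact closed_halfspace_at compact_prism)
  then have D: "?D \<in> sets borel" "emeasure lborel ?D < \<infinity>"
    using borel_compact emeasure_compact_finite by blast+
  have slice: "emeasure lborel {x::real^2. vector [x $ 1, x $ 2, s] \<in> ?D} = ennreal (indicator {-1..1} s * U s)" for s
  proof -
    have inner: "v \<bullet> (vector [x $ 1, x $ 2, s] - p) = vector [v $ 1, v $ 2] \<bullet> x + v $ 3 * s - v \<bullet> p" for x :: "real^2"
      by (simp add: inner_diff_right) (simp add: inner_vec_def sum_2 sum_3)
    have eq: "{x::real^2. vector [x $ 1, x $ 2, s] \<in> ?D}
        = (if \<bar>s\<bar> \<le> 1 then {x \<in> prism_base. v \<bullet> p - v $ 3 * s \<le> vector [v $ 1, v $ 2] \<bullet> x} else {})"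
      by (auto simp: halfspace_at_def inner mem_prism_base prism_def)
    have "prism_base \<inter> {x. vector [v $ 1, v $ 2] \<bullet> x \<ge> v \<bullet> p - v $ 3 * s} \<in> fmeasurable lborel"
      unfolding prism_base_def by (intro fmeasurable_compact compact_Int_closed closed_halfspace_ge
          finite_imp_compact_convex_hull) auto
    moreover have "prism_base \<inter> {x. vector [v $ 1, v $ 2] \<bullet> x \<ge> v \<bullet> p - v $ 3 * s}
        = {x \<in> prism_base. v \<bullet> p - v $ 3 * s \<le> vector [v $ 1, v $ 2] \<bullet> x}"
      by auto
    ultimately have "emeasure lborel {x \<in> prism_base. v \<bullet> p - v $ 3 * s \<le> vector [v $ 1, v $ 2] \<bullet> x} = U s"
      unfolding U_def upper_area_def using emeasure_eq_measure2 by metis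
    then show ?thesis
      unfolding eq by (cases "\<bar>s\<bar> \<le> 1") (auto simp: indicator_def)
  qed
  have nonneg: "0 \<le> indicator {-1..1} s * U s" for s
    by (simp add: U_def upper_area_nonneg)
  note slices = emeasure_lborel_real3_slices[OF D(1), unfolded slice]
  have "(\<lambda>s. enn2real (ennreal (indicator {-1..1} s * U s))) \<in> borel_measurable borel"
    using slices(2) by measurable
  then have meas: "(\<lambda>s. indicator {-1..1} s * U s) \<in> borel_measurable lborel"
    using nonneg by simp
  have "integrable lborel (\<lambda>s. indicator {-1..1} s * U s)"
    using meas slices(1) D(2) nonneg by (intro integrableI_nonneg) auto
  then show int: "set_integrable lborel {-1..1} U"
    by (simp add: set_integrable_def)
  have "measure lebesgue ?D = measure lborel ?D"
    using D(1) by (intro measure_completion) simp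
  also have "\<dots> = enn2real (\<integral>\<^sup>+ s. ennreal (indicator {-1..1} s * U s) \<partial>lborel)"
    using slices(1) by (simp add: measure_def)
  also have "\<dots> = (LINT s|lborel. indicator {-1..1} s * U s)"
    using meas nonneg by (intro integral_eq_nn_integral[symmetric]) auto
  finally show "measure lebesgue ?D = (LINT s:{-1..1}|lborel. U s)"
    by (simp add: set_lebesgue_integral_def)
qed

lemma measure_prism: "measure lebesgue prism = 1"
proof -
  have "halfspace_at 0 0 \<inter> prism = prism"
    by (auto simp: halfspace_at_def)
  then have "measure lebesgue prism = (LINT s:{-1..1::real}|lborel. upper_area (vector [0, 0]) prism_base 0)"
    using measure_halfspace_prism[of 0 0] by simp
  also have "(vector [0, 0] :: real^2) = 0"
    by (simp add: vec_eq_iff forall_2)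
  also have "upper_area 0 prism_base 0 = 1/2"
    by (simp add: upper_area_def measure_prism_base)
  finally show ?thesis
    by (simp add: set_lebesgue_integral_def content_real)
qed

lemma cut_fraction_prism:
  "cut_fraction prism p v =
     (LINT s:{-1..1}|lborel. upper_area (vector [v $ 1, v $ 2]) prism_base (v \<bullet> p - v $ 3 * s))"
  by (simp add: cut_fraction_def measure_halfspace_prism measure_prism)

lemma cut_fraction_prism_vertical:
  assumes "v $ 3 = 0"
  shows "cut_fraction prism p v = 2 * upper_area (vector [v $ 1, v $ 2]) prism_base (v \<bullet> p)"
proof -
  have "(LINT s:{-1..1::real}|lborel. k) = 2 * k" for k :: real
    by (simp add: set_lebesgue_integral_def content_real)
  then show ?thesis
    unfolding cut_fraction_prism assms by simp
qed

definition prism_center :: "real^3" where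
  "prism_center = vector [1/3, 1/3, 0]"

text \<open>Through the center, the slices at heights \<open>s\<close> and \<open>- s\<close> lie above opposite levels relative to the
  mean of \<open>w\<close>. So a tilted plane always leaves more than \<open>4/9\<close> on either side, and for a vertical one all
  slices are the same section of the base through its centroid. Equality therefore forces a vertical
  plane that is parallel to a side of the base.\<close>

lemma cut_fraction_prism_center:
  "4/9 < cut_fraction prism prism_center v \<or>
   cut_fraction prism prism_center v = 4/9 \<and> v $ 3 = 0 \<and> (v $ 1 = v $ 2 \<or> v $ 2 = 0 \<or> v $ 1 = 0)"
proof -
  let ?w = "vector [v $ 1, v $ 2] :: real^2" and ?c = "(v $ 1 + v $ 2) / 3"
  have inner: "?w \<bullet> axis 1 1 = v $ 1" "?w \<bullet> axis 2 1 = v $ 2" "v \<bullet> prism_center = ?c"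
    by (simp_all add: inner_axis inner_vec_def sum_2 sum_3 axis_def prism_center_def)
  have M: "0 < measure lborel (convex hull {0, axis 1 1, axis 2 1 :: real^2})"
    using measure_prism_base by (simp add: prism_base_def)
  note zero = upper_area_through_centroid[OF M, of ?w, folded prism_base_def, unfolded inner inner_zero_right add_0 measure_prism_base]
    and opposite = upper_area_opposite_levels[OF M, of _ ?w, folded prism_base_def, unfolded inner inner_zero_right add_0 measure_prism_base]
  show ?thesis
  proof (cases "v $ 3 = 0")
    case True
    then show ?thesis
      using zero cut_fraction_prism_vertical[OF True, of prism_center] by (auto simp: inner)
  next
    case False
    \<comment> \<open>The exceptional levels of the planar estimate; they occur at finitely many heights.\<close>
    define E where "E = {0, \<bar>0 - ?c\<bar>, \<bar>v $ 1 - ?c\<bar>, \<bar>v $ 2 - ?c\<bar>}"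
    have "finite ((\<lambda>e. e / v $ 3) ` (E \<union> uminus ` E))" (is "finite ?N")
      by (simp add: E_def)
    then have "AE s in lborel. s \<notin> ?N"
      by (intro AE_not_in finite_imp_null_set_lborel)
    moreover have pair: "4/9 < upper_area ?w prism_base (?c - v $ 3 * s) + upper_area ?w prism_base (?c - v $ 3 * (- s))"
      if s: "s \<notin> ?N" for s
    proof -
      define y where "y = v $ 3 * s"
      have "s = y / v $ 3"
        using False by (simp add: y_def)
      then have y: "y \<notin> E \<union> uminus ` E"
        using s by blast
      have "\<bar>y\<bar> \<notin> E"
        using y image_eqI[of y uminus "- y" E] by (cases "0 \<le> y") auto
      then have "0 < \<bar>y\<bar>" "\<bar>y\<bar> \<notin> {\<bar>0 - ?c\<bar>, \<bar>v $ 1 - ?c\<bar>, \<bar>v $ 2 - ?c\<bar>}"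
        by (auto simp: E_def)
      from opposite[OF this] have "4/9 < upper_area ?w prism_base (?c + \<bar>y\<bar>) + upper_area ?w prism_base (?c - \<bar>y\<bar>)"
        by simp
      then have "4/9 < upper_area ?w prism_base (?c - y) + upper_area ?w prism_base (?c + y)"
        by (cases "0 \<le> y") (simp_all add: add.commute)
      then show ?thesis
        by (simp add: y_def)
    qed
    ultimately have "AE s in lborel. s \<in> {-1..1} \<longrightarrow>
        4/9 < upper_area ?w prism_base (?c - v $ 3 * s) + upper_area ?w prism_base (?c - v $ 3 * (- s))"
      by eventually_elim (rule pair)
    with set_integral_reflection_gt[OF set_integrable_slices[of v prism_center]]
    have "4/9 < cut_fraction prism prism_center v"
      unfolding cut_fraction_prism inner by blast
    then show ?thesis
      by blast
  qed
qed

text \<open>The inner normals of the three vertical half-spaces that contain one vertical edge of the prism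
  and whose boundary is parallel to the opposite face.\<close>

definition side_normals :: "(real^3) set" where
  "side_normals = {axis 1 1, axis 2 1, - axis 1 1 - axis 2 1}"

lemma cut_fraction_vertex_side:
  assumes "0 \<le> p $ 1" "0 \<le> p $ 2" "p $ 1 < 1" "p $ 2 < 1" "0 < p $ 1 + p $ 2" "p $ 1 + p $ 2 \<le> 1"
  shows "cut_fraction prism p (axis 1 1) = (1 - p $ 1)\<^sup>2"
    and "cut_fraction prism p (axis 2 1) = (1 - p $ 2)\<^sup>2"
    and "cut_fraction prism p (- axis 1 1 - axis 2 1) = (p $ 1 + p $ 2)\<^sup>2"
proof -
  have inner: "(vector [a, b] :: real^2) \<bullet> axis 1 1 = a" "(vector [a, b] :: real^2) \<bullet> axis 2 1 = b" for a b :: real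
    by (simp_all add: inner_axis)
  have base: "prism_base = convex hull {axis 1 1, 0, axis 2 1}" "prism_base = convex hull {axis 2 1, 0, axis 1 1}"
    by (simp_all add: prism_base_def insert_commute)
  have nth: "(axis 1 1 :: real^3) $ 1 = 1" "(axis 1 1 :: real^3) $ 2 = 0" "(axis 1 1 :: real^3) $ 3 = 0"
      "(axis 2 1 :: real^3) $ 1 = 0" "(axis 2 1 :: real^3) $ 2 = 1" "(axis 2 1 :: real^3) $ 3 = 0"
    by (simp_all add: axis_def)
  show "cut_fraction prism p (axis 1 1) = (1 - p $ 1)\<^sup>2"
    using assms upper_area_corner[of "p $ 1" "vector [1, 0]" "axis 1 1" 0 "axis 2 1", folded base]
    by (simp add: cut_fraction_prism_vertical nth inner_axis' inner measure_prism_base)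
  show "cut_fraction prism p (axis 2 1) = (1 - p $ 2)\<^sup>2"
    using assms upper_area_corner[of "p $ 2" "vector [0, 1]" "axis 2 1" 0 "axis 1 1", folded base]
    by (simp add: cut_fraction_prism_vertical nth inner_axis' inner measure_prism_base)
  show "cut_fraction prism p (- axis 1 1 - axis 2 1) = (p $ 1 + p $ 2)\<^sup>2"
    using assms upper_area_corner[of "- p $ 1 - p $ 2" "vector [-1, -1]" 0 "axis 1 1" "axis 2 1", folded prism_base_def]
    by (simp add: cut_fraction_prism_vertical nth inner_axis' inner measure_prism_base inner_diff_left add.commute)
qed

text \<open>Among the half-spaces through the center that leave \<open>4/9\<close> there is one with normal \<open>(1, 0, 0)\<close>. For a
  point off the middle height, tilting it by \<open>z / 4\<close> makes the slices smaller on average: the mean side length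
  of the corners drops by a multiple of \<open>z\<^sup>2\<close>, and the variance between the slices, also of order
  \<open>z\<^sup>2\<close>, has a smaller coefficient. The factor \<open>1/4\<close> is small enough that every slice is still a corner of the base.\<close>

lemma cut_fraction_tilted:
  assumes p: "p = vector [1/3, 1/3, z]" and z: "z \<noteq> 0" "\<bar>z\<bar> \<le> 1"
  shows "cut_fraction prism p (vector [1, 0, z / 4]) < 4/9"
proof -
  let ?v = "vector [1, 0, z / 4] :: real^3" and ?U = "upper_area (vector [1, 0]) prism_base"
  have base: "prism_base = convex hull {axis 1 1, 0, axis 2 1}"
    by (simp add: prism_base_def insert_commute)
  have level: "?v \<bullet> p - ?v $ 3 * s = 1/3 - z * (s - z) / 4" for s
    by (simp add: p inner_vec_def sum_3 field_simps power2_eq_square)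
  have U: "?U (?v \<bullet> p - ?v $ 3 * s) = (2/3 + z * (s - z) / 4)\<^sup>2 / 2" if "\<bar>s\<bar> \<le> 1" for s
  proof -
    have "\<bar>z * s\<bar> \<le> 1 * 1"
      unfolding abs_mult using z that by (intro mult_mono) auto
    moreover have "0 \<le> z * z" "z * z \<le> 1"
      using z by (auto simp: abs_square_le_1 power2_eq_square[symmetric])
    ultimately have "z * (s - z) \<le> 1" "- 2 \<le> z * (s - z)"
      unfolding right_diff_distrib by linarith+
    then show ?thesis
      unfolding level using upper_area_corner[of "1/3 - z * (s - z) / 4" "vector [1, 0]" "axis 1 1" 0 "axis 2 1", folded base]
      by (simp add: inner_axis measure_prism_base)
  qed
  have z2: "0 < z\<^sup>2" "z\<^sup>2 \<le> 1"
    using z by (simp_all add: abs_square_le_1)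
  have "(LINT s:{-1..1}|lborel. ?U (?v \<bullet> p - ?v $ 3 * s)) < 4/9"
  proof (rule set_integral_reflection_lt)
    show "set_integrable lborel {-1..1} (\<lambda>s. ?U (?v \<bullet> p - ?v $ 3 * s))"
      using set_integrable_slices[of ?v p] by simp
    fix s :: real assume s: "s \<in> {-1..1}"
    have "z\<^sup>2 * s\<^sup>2 \<le> z\<^sup>2"
      using s by (intro mult_left_le) (auto simp: abs_square_le_1)
    moreover have "z\<^sup>2 * z\<^sup>2 \<le> z\<^sup>2"
      using z2 by (intro mult_left_le) auto
    moreover have "(2/3 + z * (s - z) / 4)\<^sup>2 / 2 + (2/3 + z * (- s - z) / 4)\<^sup>2 / 2
        = 4/9 - z\<^sup>2 / 3 + z\<^sup>2 * z\<^sup>2 / 16 + z\<^sup>2 * s\<^sup>2 / 16"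
      by (simp add: power2_eq_square field_simps)
    ultimately have "(2/3 + z * (s - z) / 4)\<^sup>2 / 2 + (2/3 + z * (- s - z) / 4)\<^sup>2 / 2 < 4/9"
      using z2(1) by linarith
    moreover have "\<bar>s\<bar> \<le> 1" "\<bar>- s\<bar> \<le> 1"
      using s by auto
    ultimately show "?U (?v \<bullet> p - ?v $ 3 * s) + ?U (?v \<bullet> p - ?v $ 3 * (- s)) < 4/9"
      by (simp only: U)
  qed
  then show ?thesis
    by (simp add: cut_fraction_prism)
qed

lemma depth_le_cut_fraction:
  assumes "v \<noteq> 0"
  shows "depth p K \<le> cut_fraction K p v"
proof -
  have "cut_fraction K p v = cut_fraction K p ((1 / norm v) *\<^sub>R v)"
    using assms cut_fraction_scaleR[of "1 / norm v" K p v] by simp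
  moreover have "bdd_below (cut_fraction K p ` sphere 0 1)"
    by (rule bdd_belowI2[of _ 0]) (simp add: cut_fraction_def)
  ultimately show ?thesis
    using assms unfolding depth_def by (auto intro: cINF_lower)
qed

lemma prism_center_nth [simp]: "prism_center $ 1 = 1/3" "prism_center $ 2 = 1/3" "prism_center $ 3 = 0"
  by (simp_all add: prism_center_def)

lemma side_normals_nonzero: "v \<in> side_normals \<Longrightarrow> v \<noteq> 0"
  by (auto simp: side_normals_def vec_eq_iff forall_3 axis_def)

lemma cut_fraction_prism_center_side_normals:
  "v \<in> side_normals \<Longrightarrow> cut_fraction prism prism_center v = 4/9"
  using cut_fraction_vertex_side[of prism_center] by (auto simp: side_normals_def power2_eq_square)

lemma depth_prism_center: "depth prism_center prism = 4/9"
proof (rule antisym)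
  show "depth prism_center prism \<le> 4/9"
    using depth_le_cut_fraction[of "axis 1 1" prism_center prism]
      cut_fraction_prism_center_side_normals[of "axis 1 1"] by (simp add: side_normals_def)
  show "4/9 \<le> depth prism_center prism"
    unfolding depth_def
  proof (rule cINF_greatest)
    show "sphere (0 :: real^3) 1 \<noteq> {}"
      by simp
    show "4/9 \<le> cut_fraction prism prism_center v" for v
      using cut_fraction_prism_center[of v] by auto
  qed
qed

lemma prism_center_interior: "prism_center \<in> interior prism"
proof (rule interiorI)
  let ?S = "{y :: real^3. 0 < y $ 1 \<and> 0 < y $ 2 \<and> y $ 1 + y $ 2 < 1 \<and> \<bar>y $ 3\<bar> < 1}"
  show "open ?S"
    by (intro open_Collect_conj open_Collect_less continuous_intros)
  show "prism_center \<in> ?S" "?S \<subseteq> prism"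
    by (auto simp: prism_def)
qed

lemma interior_prism_strict:
  assumes "p \<in> interior prism"
  shows "p $ 1 < 1" "p $ 2 < 1" "0 < p $ 1 + p $ 2"
proof -
  have int: "a \<bullet> p < b" if "prism \<subseteq> {y. a \<bullet> y \<le> b}" "a \<noteq> 0" for a b
    using interior_mono[OF that(1)] interior_halfspace_le[OF that(2)] assms by auto
  have "prism \<subseteq> {y. axis 1 1 \<bullet> y \<le> 1}" "prism \<subseteq> {y. axis 2 1 \<bullet> y \<le> 1}"
      "prism \<subseteq> {y. (- axis 1 1 - axis 2 1) \<bullet> y \<le> 0}"
    by (auto simp: prism_def inner_axis' inner_diff_left)
  note this[THEN int]
  moreover have "- axis 1 1 - axis 2 1 \<noteq> (0 :: real^3)"
    using side_normals_nonzero[of "- axis 1 1 - axis 2 1"] unfolding side_normals_def by blast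
  ultimately show "p $ 1 < 1" "p $ 2 < 1" "0 < p $ 1 + p $ 2"
    by (auto simp: inner_axis' inner_diff_left simp del: diff_eq_eq)
qed

text \<open>A half-space through \<open>p\<close> with normal in \<open>side_normals\<close> leaves \<open>(1 - \<lambda>)\<^sup>2\<close>, where \<open>\<lambda>\<close> is a barycentric coordinate of the
  projection of \<open>p\<close> to the base. Depth at least \<open>4/9\<close> gives \<open>\<lambda> \<le> 1/3\<close> for all three coordinates, which
  sum to \<open>1\<close>; so \<open>p\<close> lies above the centroid, and a tilted plane excludes all heights but the middle.\<close>

lemma max_depth_point_prism:
  assumes "max_depth_point prism p"
  shows "p = prism_center"
proof -
  have p: "p \<in> interior prism" and "4/9 \<le> depth p prism"
    using assms prism_center_interior depth_prism_center by (auto simp: max_depth_point_def)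
  then have deep: "4/9 \<le> cut_fraction prism p v" if "v \<noteq> 0" for v
    using depth_le_cut_fraction[OF that, of p prism] by simp
  have "p \<in> prism"
    using p interior_subset by blast
  note p_in = this[unfolded prism_def, simplified] interior_prism_strict[OF p]
  note cuts = cut_fraction_vertex_side[of p]
  have sq: "2/3 \<le> x" if "4/9 \<le> x\<^sup>2" "0 \<le> x" for x :: real
    using that power2_le_imp_le[of "2/3" x] by (simp add: power2_eq_square)
  have "4/9 \<le> (1 - p $ 1)\<^sup>2" "4/9 \<le> (1 - p $ 2)\<^sup>2" "4/9 \<le> (p $ 1 + p $ 2)\<^sup>2"
    using deep[of "axis 1 1"] deep[of "axis 2 1"] deep[of "- axis 1 1 - axis 2 1"]
      side_normals_nonzero[of "- axis 1 1 - axis 2 1"] cuts p_in by (auto simp: side_normals_def)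
  from this[THEN sq] have "2/3 \<le> 1 - p $ 1" "2/3 \<le> 1 - p $ 2" "2/3 \<le> p $ 1 + p $ 2"
    using p_in by auto
  then have xy: "p $ 1 = 1/3" "p $ 2 = 1/3"
    by linarith+
  have "p $ 3 = 0"
  proof (rule ccontr)
    assume "p $ 3 \<noteq> 0"
    moreover have "p = vector [1/3, 1/3, p $ 3]"
      using xy by (simp add: vec_eq_iff forall_3)
    ultimately have "cut_fraction prism p (vector [1, 0, p $ 3 / 4]) < 4/9"
      using cut_fraction_tilted p_in by blast
    moreover have "vector [1, 0, p $ 3 / 4] \<noteq> (0 :: real^3)"
      by (simp add: vec_eq_iff forall_3)
    ultimately show False
      using deep by fastforce
  qed
  then show ?thesis
    using xy by (simp add: vec_eq_iff forall_3)
qed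

lemma realizes_depth_prism:
  "{h. realizes_depth prism prism_center h} = hyperplane_at prism_center ` side_normals"
proof (intro equalityI subsetI)
  fix h assume "h \<in> {h. realizes_depth prism prism_center h}"
  then obtain v where v: "norm v = 1" "h = hyperplane_at prism_center v" "cut_fraction prism prism_center v = 4/9"
    by (auto simp: realizes_depth_def depth_prism_center)
  then have "v $ 3 = 0" "v $ 1 = v $ 2 \<or> v $ 2 = 0 \<or> v $ 1 = 0"
    using cut_fraction_prism_center[of v] by auto
  then have "v = (- v $ 1) *\<^sub>R (- axis 1 1 - axis 2 1) \<or> v = (v $ 1) *\<^sub>R axis 1 1 \<or> v = (v $ 2) *\<^sub>R axis 2 1"
    by (auto simp: vec_eq_iff forall_3 axis_def)
  then obtain k u where ku: "v = k *\<^sub>R u" "u \<in> side_normals"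
    unfolding side_normals_def by blast
  then have "k \<noteq> 0"
    using v(1) by auto
  then show "h \<in> hyperplane_at prism_center ` side_normals"
    using ku v(2) hyperplane_at_scaleR by blast
next
  fix h assume "h \<in> hyperplane_at prism_center ` side_normals"
  then obtain u where u: "u \<in> side_normals" "h = hyperplane_at prism_center u"
    by blast
  let ?v = "(1 / norm u) *\<^sub>R u"
  have "0 < 1 / norm u"
    using side_normals_nonzero[OF u(1)] by simp
  then have "h = hyperplane_at prism_center ?v" "cut_fraction prism prism_center ?v = 4/9" "norm ?v = 1"
    using u hyperplane_at_scaleR[of "1 / norm u" _ u] cut_fraction_scaleR[of "1 / norm u" _ _ u]
      cut_fraction_prism_center_side_normals[OF u(1)] side_normals_nonzero[OF u(1)] by auto
  then show "h \<in> {h. realizes_depth prism prism_center h}"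
    unfolding realizes_depth_def depth_prism_center mem_Collect_eq by (intro bexI[of _ ?v]) auto
qed

lemma card_realizes_depth_prism: "card {h. realizes_depth prism prism_center h} = 3"
proof -
  let ?H = "hyperplane_at prism_center" and ?x = "axis 1 1 :: real^3" and ?y = "axis 2 1 :: real^3"
  \<comment> \<open>Moving from the center along a side of the base stays in the hyperplane of that side only.\<close>
  have "prism_center + ?y \<in> ?H ?x" "prism_center + ?y \<notin> ?H ?y" "prism_center + ?y \<notin> ?H (- ?x - ?y)"
     "prism_center + ?x \<in> ?H ?y" "prism_center + ?x \<notin> ?H (- ?x - ?y)"
    by (auto simp: hyperplane_at_def inner_diff_left inner_axis_axis)
  then have "?H ?x \<noteq> ?H ?y" "?H ?x \<noteq> ?H (- ?x - ?y)" "?H ?y \<noteq> ?H (- ?x - ?y)"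
    by metis+
  then show ?thesis
    by (simp add: realizes_depth_prism side_normals_def)
qed

text \<open>The barycenter is fixed by every affine symmetry. The one used here permutes the vertices of the base
  cyclically and reverses the height; the center is its only fixed point.\<close>

lemma barycenter_prism: "barycenter prism = prism_center"
proof -
  define L :: "real^3 \<Rightarrow> real^3" where "L = (\<lambda>y. vector [- y $ 1 - y $ 2, y $ 1, - y $ 3])"
  let ?q = "axis 1 1 :: real^3"
  have L: "linear L"
    by (rule linearI) (simp_all add: L_def vec_eq_iff forall_3 algebra_simps)
  have inj: "inj L"
    by (auto simp: inj_def L_def vec_eq_iff forall_3)
  have "(\<lambda>y. ?q + L y) ` prism = prism"
  proof (intro equalityI subsetI)
    fix y assume y: "y \<in> prism"
    let ?x = "vector [y $ 2, 1 - y $ 1 - y $ 2, - y $ 3] :: real^3"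
    have "?x \<in> prism" "y = ?q + L ?x"
      using y by (auto simp: prism_def L_def vec_eq_iff forall_3 axis_def)
    then show "y \<in> (\<lambda>y. ?q + L y) ` prism"
      by blast
  qed (auto simp: prism_def L_def axis_def)
  then have "barycenter prism = ?q + L (barycenter prism)"
    using barycenter_affine_image[OF L inj compact_prism, of ?q] measure_prism by simp
  then have "\<forall>i. barycenter prism $ i = (?q + L (barycenter prism)) $ i"
    by simp
  then show ?thesis
    by (simp add: L_def vec_eq_iff forall_3 axis_def)
qed

section \<open>Prisms over an equilateral triangle\<close>

text \<open>The parameter \<open>y\<^sub>3 \<in> [-1, 1]\<close> runs through the segment from \<open>d\<close> to \<open>e\<close> symmetrically about its
  midpoint.\<close>

lemma triangular_prism_affine_image:
  fixes a b c d e :: "real^3"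
  defines "L \<equiv> \<lambda>y :: real^3. (y $ 1) *\<^sub>R (b - a) + (y $ 2) *\<^sub>R (c - a) + (y $ 3) *\<^sub>R ((1/2) *\<^sub>R (e - d))"
  shows "internal_product (convex hull {a, b, c}) (closed_segment d e)
     = (\<lambda>y. (a + (1/2) *\<^sub>R (d + e)) + L y) ` prism"
proof (intro equalityI subsetI)
  fix x assume "x \<in> internal_product (convex hull {a, b, c}) (closed_segment d e)"
  then obtain t i where x: "x = t + i" "t \<in> convex hull {a, b, c}" "i \<in> closed_segment d e"
    by (auto simp: internal_product_def)
  obtain u v w where t: "0 \<le> u" "0 \<le> v" "0 \<le> w" "u + v + w = 1" "t = u *\<^sub>R a + v *\<^sub>R b + w *\<^sub>R c"
    using x(2) by (auto simp: convex_hull_3)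
  obtain s where i: "0 \<le> s" "s \<le> 1" "i = (1 - s) *\<^sub>R d + s *\<^sub>R e"
    using x(3) by (auto simp: closed_segment_def)
  let ?y = "vector [v, w, 2 * s - 1] :: real^3"
  have u: "u = 1 - v - w"
    using t(4) by simp
  have "?y \<in> prism"
    using t i by (auto simp: prism_def)
  moreover have "x = a + (1/2) *\<^sub>R (d + e) + L ?y"
    unfolding x(1) t(5) i(3) u by (simp add: L_def vec_eq_iff field_simps)
  ultimately show "x \<in> (\<lambda>y. (a + (1/2) *\<^sub>R (d + e)) + L y) ` prism"
    by blast
next
  fix x assume "x \<in> (\<lambda>y. (a + (1/2) *\<^sub>R (d + e)) + L y) ` prism"
  then obtain y where y: "y \<in> prism" "x = a + (1/2) *\<^sub>R (d + e) + L y"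
    by blast
  let ?t = "(1 - y $ 1 - y $ 2) *\<^sub>R a + (y $ 1) *\<^sub>R b + (y $ 2) *\<^sub>R c" and ?s = "(1 + y $ 3) / 2"
  have "?t \<in> convex hull {a, b, c}"
    unfolding convex_hull_3 using y(1)
    by (intro CollectI exI[of _ "1 - y $ 1 - y $ 2"] exI[of _ "y $ 1"] exI[of _ "y $ 2"]) (auto simp: prism_def)
  moreover have "(1 - ?s) *\<^sub>R d + ?s *\<^sub>R e \<in> closed_segment d e"
    unfolding closed_segment_def using y(1) by (auto simp: prism_def intro!: exI[of _ ?s])
  moreover have "x = ?t + ((1 - ?s) *\<^sub>R d + ?s *\<^sub>R e)"
    unfolding y(2) by (simp add: L_def vec_eq_iff field_simps)
  ultimately show "x \<in> internal_product (convex hull {a, b, c}) (closed_segment d e)"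
    unfolding internal_product_def by blast
qed

text \<open>For two sides of an equilateral triangle \<open>2 * (u \<bullet> v) = u \<bullet> u\<close>, so their Gram determinant is
  \<open>3/4 * (u \<bullet> u)\<^sup>2\<close>, and \<open>k\<close> is orthogonal to their plane.\<close>

lemma inj_prism_frame:
  fixes u v k :: "real^3"
  assumes "u \<noteq> 0" "norm u = norm v" "norm (u - v) = norm u" "u \<bullet> k = 0" "v \<bullet> k = 0" "k \<noteq> 0"
  shows "inj (\<lambda>y :: real^3. (y $ 1) *\<^sub>R u + (y $ 2) *\<^sub>R v + (y $ 3) *\<^sub>R k)" (is "inj ?L")
proof -
  have lin: "linear ?L"
    by (rule linearI) (simp_all add: algebra_simps)
  have "y = 0" if y: "?L y = 0" for y
  proof -
    let ?r = "u \<bullet> u"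
    have r: "0 < ?r" "v \<bullet> v = ?r" "(u - v) \<bullet> (u - v) = ?r"
      using assms(1-3) unfolding inner_gt_zero_iff dot_square_norm by auto
    then have uv: "2 * (u \<bullet> v) = ?r"
      by (simp add: inner_diff_left inner_diff_right inner_commute)
    have dots: "?L y \<bullet> u = 0" "?L y \<bullet> v = 0" "?L y \<bullet> k = 0"
      using y by simp_all
    have "y $ 3 = 0"
      using dots(3) assms by (simp add: inner_add_left)
    moreover have "y $ 1 * ?r + y $ 2 * (u \<bullet> v) = 0" "y $ 1 * (u \<bullet> v) + y $ 2 * ?r = 0"
      using dots(1,2) r(2) assms(4,5) by (simp_all add: inner_add_left inner_add_right inner_commute)
    then have "?r * (2 * y $ 1 + y $ 2) = 0" "?r * (y $ 1 + 2 * y $ 2) = 0"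
      using uv by algebra+
    ultimately have "y $ 1 = 0" "y $ 2 = 0" "y $ 3 = 0"
      using r(1) by auto
    then show ?thesis
      by (simp add: vec_eq_iff forall_3)
  qed
  then show ?thesis
    using linear_injective_0[OF lin] by blast
qed

theorem proposition5:
  fixes T I K :: "(real ^ 3) set" and p0 :: "real ^ 3"
  assumes "equilateral_triangle T"
    and "nondegenerate_segment I"
    and "orthogonal_sets T I"
    and "K = internal_product T I"
    and "max_depth_point K p0"
  shows "p0 = barycenter K \<and> card {h. realizes_depth K p0 h} = 3"
proof -
  obtain a b c where T: "a \<noteq> b" "dist a b = dist b c" "dist b c = dist c a" "T = convex hull {a, b, c}"
    using assms(1) by (auto simp: equilateral_triangle_def)
  obtain d e where I: "d \<noteq> e" "I = closed_segment d e"
    using assms(2) by (auto simp: nondegenerate_segment_def)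
  define L where "L = (\<lambda>y :: real^3. (y $ 1) *\<^sub>R (b - a) + (y $ 2) *\<^sub>R (c - a) + (y $ 3) *\<^sub>R ((1/2) *\<^sub>R (e - d)))"
  define q where "q = a + (1/2) *\<^sub>R (d + e)"
  have K: "K = (\<lambda>y. q + L y) ` prism"
    unfolding assms(4) T(4) I(2) triangular_prism_affine_image L_def q_def ..
  have lin: "linear L"
    unfolding L_def by (rule linearI) (simp_all add: algebra_simps)
  have "a \<in> T" "b \<in> T" "c \<in> T" "d \<in> I" "e \<in> I"
    by (simp_all add: T(4) I(2) hull_inc)
  then have "orthogonal (b - a) (e - d)" "orthogonal (c - a) (e - d)"
    using assms(3) by (auto simp: orthogonal_sets_def)
  moreover have "b - a - (c - a) = b - c"
    by simp
  ultimately have inj: "inj L"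
    unfolding L_def using T I(1)
    by (intro inj_prism_frame) (auto simp: orthogonal_def dist_norm norm_minus_commute)
  then have "surj L"
    using linear_injective_imp_surjective lin by blast
  then obtain p where p: "p0 = q + L p"
    by (metis surjD add.commute diff_add_cancel)
  then have "p = prism_center"
    using max_depth_point_prism max_depth_point_affine_image[OF lin inj compact_prism] assms(5) K by blast
  moreover have "inj (\<lambda>y. q + L y)"
    using inj by (simp add: inj_def)
  then have "inj (image (\<lambda>y. q + L y))"
    by (simp add: inj_def[of "image _"] inj_image_eq_iff)
  ultimately show ?thesis
    using barycenter_affine_image[OF lin inj compact_prism, of q] measure_prism barycenter_prism
      realizes_depth_affine_image[OF lin inj compact_prism, of q p] card_realizes_depth_prism K p
    by (simp add: card_image inj_on_subset)
qed

end
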